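(* For $m\ge 0$ let $\delta_m=m(m-1)\cdots 21$ be the decreasing permutation of length $m$. For every $n\ge 1$, the set of $123$-sorted permutations of length $n$ is the disjoint union $$\mathrm{Sorted}_n(123)=\bigl\{\delta_h\ominus(\delta_{k-1}\oplus\delta_{t+1}) : k\ge 2,\ h,t\ge 0,\ k+h+t=n\bigr\}\ \dot\cup\ \{\delta_n\}.$$ Moreover, for $k\ge 2$ and $h,t\ge 0$, the $123$-fertility of $\delta_h\ominus(\delta_{k-1}\oplus\delta_{t+1})$ is equal to the Catalan number $\mathfrak{c}_{k-1}=\frac{1}{k}\binom{2k-2}{k-1}$.
   Context: For permutations $x$ of length $a$ and $y$ of length $b$, the direct sum $x\oplus y$ (resp. skew sum $x\ominus y$) is the permutation of length $a+b$ whose first $a$ entries are order isomorphic to $x$, whose last $b$ entries are order isomorphic to $y$, and in which each of the first $a$ entries is smaller (resp. larger) than each of the last $b$ entries; $\delta_0$ is the empty permutation. For a permutation $\sigma$ of length at least $2$, the $\sigma$-stack acts on an input permutation $\pi=\pi_1\cdots\pi_n$ as follows (starting with empty stack and output). For $i=1,\dots,n$: as long as pushing $\pi_i$ on top of the stack would make the content of the stack, read from top to bottom, contain an occurrence of $\sigma$ (a subsequence order isomorphic to $\sigma$), pop the top element and append it to the output; then push $\pi_i$. After all letters have been pushed, pop all remaining elements, from top to bottom, appending them to the output. The resulting output is denoted $\mathcal{S}^{\sigma}(\pi)$. The permutation $\pi$ of length $n$ is $\sigma$-sortable if $\mathcal{S}^{21}(\mathcal{S}^{\sigma}(\pi))=12\cdots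 n$. A permutation is $\sigma$-sorted if it equals $\mathcal{S}^{\sigma}(\pi)$ for some $\sigma$-sortable $\pi$; $\mathrm{Sorted}_n(\sigma)$ is the set of $\sigma$-sorted permutations of length $n$. The $\sigma$-fertility of a permutation $\gamma$ is the number of permutations $\pi$ with $\mathcal{S}^{\sigma}(\pi)=\gamma$. *)

theory Defs
  imports "HOL-Combinatorics.Multiset_Permutations" "HOL-Library.Sublist" Complex_Main
begin

text \<open>Permutations of length \<open>n\<close> are written in one-line notation, as lists over \<open>{1..n}\<close>.\<close>

definition is_perm :: "nat list \<Rightarrow> bool" where
  "is_perm p \<longleftrightarrow> p \<in> permutations_of_set {1..length p}"

definition order_iso :: "nat list \<Rightarrow> nat list \<Rightarrow> bool" where
  "order_iso xs ys \<longleftrightarrow> length xs = length ys \<and>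
     (\<forall>i<length xs. \<forall>j<length xs. xs ! i < xs ! j \<longleftrightarrow> ys ! i < ys ! j)"

definition contains_pattern :: "nat list \<Rightarrow> nat list \<Rightarrow> bool" where
  "contains_pattern xs s \<longleftrightarrow> (\<exists>ys. subseq ys xs \<and> order_iso ys s)"

definition direct_sum :: "nat list \<Rightarrow> nat list \<Rightarrow> nat list" (infixl "\<oplus>" 65) where
  "x \<oplus> y = x @ map (\<lambda>v. length x + v) y"

definition skew_sum :: "nat list \<Rightarrow> nat list \<Rightarrow> nat list" (infixl "\<ominus>" 65) where
  "x \<ominus> y = map (\<lambda>v. length y + v) x @ y"

lemma direct_sum_props:
  assumes "is_perm x" "is_perm y"
  shows "is_perm (x \<oplus> y)" "length (x \<oplus> y) = length x + length y"
    "order_iso (take (length x) (x \<oplus> y)) x" "order_iso (drop (length x) (x \<oplus> y)) y"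
    "\<forall>u\<in>set (take (length x) (x \<oplus> y)). \<forall>v\<in>set (drop (length x) (x \<oplus> y)). u < v"
proof -
  have x: "set x = {1..length x}" "distinct x" and y: "set y = {1..length y}" "distinct y"
    using assms by (auto simp: is_perm_def permutations_of_set_def)
  have "(\<lambda>v. length x + v) ` {1..length y} = {length x + 1..length x + length y}"
    by simp
  then show "is_perm (x \<oplus> y)"
    using x y by (auto simp: is_perm_def permutations_of_set_def direct_sum_def distinct_map inj_on_def)
  show "\<forall>u\<in>set (take (length x) (x \<oplus> y)). \<forall>v\<in>set (drop (length x) (x \<oplus> y)). u < v"
    using x(1) y(1) by (auto simp: direct_sum_def)
qed (auto simp: direct_sum_def order_iso_def)

lemma skew_sum_props:
  assumes "is_perm x" "is_perm y"
  shows "is_perm (x \<ominus> y)" "length (x \<ominus> y) = length x + length y"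
    "order_iso (take (length x) (x \<ominus> y)) x" "order_iso (drop (length x) (x \<ominus> y)) y"
    "\<forall>u\<in>set (take (length x) (x \<ominus> y)). \<forall>v\<in>set (drop (length x) (x \<ominus> y)). u > v"
proof -
  have x: "set x = {1..length x}" "distinct x" and y: "set y = {1..length y}" "distinct y"
    using assms by (auto simp: is_perm_def permutations_of_set_def)
  have "(\<lambda>v. length y + v) ` {1..length x} = {length y + 1..length y + length x}"
    by simp
  then show "is_perm (x \<ominus> y)"
    using x y by (auto simp: is_perm_def permutations_of_set_def skew_sum_def distinct_map inj_on_def)
  show "\<forall>u\<in>set (take (length x) (x \<ominus> y)). \<forall>v\<in>set (drop (length x) (x \<ominus> y)). u > v"
    using x(1) y(1) by (auto simp: skew_sum_def)
qed (auto simp: skew_sum_def order_iso_def)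

definition decr_perm :: "nat \<Rightarrow> nat list" ("\<delta>") where
  "\<delta> m = rev [1..<Suc m]"

text \<open>
  \<open>stack_run s st xs\<close> is what is still to be output when the stack is \<open>st\<close> (head of the list on
  top) and \<open>xs\<close> is the rest of the input. A letter is pushed on an empty stack without a test,
  which changes nothing when \<open>s\<close> has length at least 2.
\<close>

fun stack_run :: "nat list \<Rightarrow> nat list \<Rightarrow> nat list \<Rightarrow> nat list" where
  "stack_run s st [] = st"
| "stack_run s [] (x # xs) = stack_run s [x] xs"
| "stack_run s (t # st) (x # xs) =
     (if contains_pattern (x # t # st) s then t # stack_run s st (x # xs)
      else stack_run s (x # t # st) xs)"

definition stack_map :: "nat list \<Rightarrow> nat list \<Rightarrow> nat list" ("\<S>") where
  "\<S> s p = stack_run s [] p"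

definition sortable :: "nat list \<Rightarrow> nat list \<Rightarrow> bool" where
  "sortable s p \<longleftrightarrow> is_perm p \<and> \<S> [2, 1] (\<S> s p) = [1..<Suc (length p)]"

definition Sorted :: "nat \<Rightarrow> nat list \<Rightarrow> nat list set" where
  "Sorted n s = {g. is_perm g \<and> length g = n \<and> (\<exists>p. sortable s p \<and> \<S> s p = g)}"

definition fertility :: "nat list \<Rightarrow> nat list \<Rightarrow> nat" where
  "fertility s g = card {p. is_perm p \<and> \<S> s p = g}"

end

theory Submission
  imports Defs
begin

text \<open>
  Let \<open>\<pi> = E @ F\<close> where \<open>E\<close> is the first ascending run of \<open>\<pi>\<close>. The 123-stack pops only while it
  contains a pair that ascends from top to bottom, and \<open>D = rev E\<close> contains none. So \<open>E\<close> is pushed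
  without pops, \<open>D\<close> stays at the bottom of the stack until the end, and the output ends with \<open>D\<close>.
  If \<open>1\<close> lies in \<open>F\<close>, it is pushed directly onto \<open>D\<close>: the first letter of \<open>F\<close> is below the top of \<open>D\<close>,
  so at all later times the lowest letter above \<open>D\<close> forms an ascending pair with the top of \<open>D\<close>, which
  the letter \<open>1\<close> has to destroy. Since \<open>1\<close> is never popped early, the output is then \<open>W @ 1 # D\<close>
  (\<open>run123_min_pushed\<close>, \<open>run123_before_min\<close>).

  The 21-stack sorts only permutations that avoid 231 (\<open>sorted_run21_avoids_231\<close>). In \<open>W @ 1 # D\<close> this
  forces \<open>W\<close> to decrease, because an ascent of \<open>W\<close> followed by \<open>1\<close> is a 231, and it forbids a letter of
  \<open>W\<close> strictly between two letters of the decreasing list \<open>D\<close>. Hence \<open>D\<close> is a block of consecutive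
  values \<open>k + t, \<dots>, k\<close>, and \<open>W @ [1]\<close> is the decreasing list of the larger values followed by
  the smaller ones: this is the skew sum of the theorem. If \<open>1\<close> lies in \<open>E\<close>, it is the first letter of
  \<open>\<pi>\<close>, hence the last one of the output, and the same argument shows that the output is decreasing.

  For the fertility, let \<open>B\<close> be the increasing list of the \<open>h\<close> values above \<open>k + t\<close>. A preimage starts with
  \<open>E = [k, \<dots>, k + t]\<close>; let \<open>\<sigma>\<close> be the sequence of its letters below \<open>k\<close>. Together with the top of \<open>D\<close>, every
  small letter in the stack forms an ascending pair, so the small letters pass through a 12-stack. The large
  letters must come out first and in decreasing order, and this happens exactly if they occur as the block
  \<open>B\<close> immediately after the first ascending run of \<open>\<sigma>\<close>: in any other arrangement some small letter leaves
  the stack before a large one, or a large letter before a larger one. So \<open>\<sigma>\<close> determines the preimage,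
  and \<open>\<sigma>\<close> is any permutation of \<open>1, \<dots>, k - 1\<close> that the 12-stack turns into a decreasing list
  (\<open>fertility_bij\<close>). Splitting \<open>\<sigma>\<close> at the letter \<open>1\<close> gives the Catalan recursion for the number of
  these (\<open>sortable12_rec\<close>).

  Conversely, all the listed permutations are 123-sorted: the skew sums have preimages by the bijection just
  described, \<open>\<delta> n\<close> is the output for the increasing input, and the 21-stack sorts each of them.
\<close>

section \<open>Occurrences of short patterns\<close>

lemma all_less_Suc_conv: "(\<forall>i<Suc n. P i) \<longleftrightarrow> P n \<and> (\<forall>i<n. P i)"
  by (auto simp: less_Suc_eq)

lemma subseq_pair_Cons:
  "subseq [a, b] (x # w) \<longleftrightarrow> (a = x \<and> b \<in> set w) \<or> subseq [a, b] w"
  by (auto simp: subseq_singleton_left dest: subseq_Cons')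

lemma subseq_pair_append:
  "subseq [a, b] (U @ V) \<longleftrightarrow> subseq [a, b] U \<or> (a \<in> set U \<and> b \<in> set V) \<or> subseq [a, b] V"
proof (induction U)
  case (Cons u U)
  then show ?case unfolding append_Cons subseq_pair_Cons by auto
qed simp

lemma sorted_wrt_iff_subseq: "sorted_wrt P w \<longleftrightarrow> (\<forall>a b. subseq [a, b] w \<longrightarrow> P a b)"
proof (induction w)
  case (Cons x w)
  then show ?case unfolding subseq_pair_Cons sorted_wrt.simps by blast
qed simp

lemma subseq_pairE:
  assumes "subseq [a, b] W" obtains X Y where "W = X @ b # Y" "a \<in> set X"
proof -
  have "\<exists>X Y. W = X @ b # Y \<and> a \<in> set X"
    using assms
  proof (induction W rule: list.induct)
    case (Cons w W)
    from Cons.prems consider "a = w" "b \<in> set W" | "subseq [a, b] W"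
      unfolding subseq_pair_Cons by blast
    then show ?case
    proof cases
      case 1
      then obtain X Y where "W = X @ b # Y" using split_list by fast
      then have "w # W = (w # X) @ b # Y" "a \<in> set (w # X)" using 1 by simp_all
      then show ?thesis by blast
    next
      case 2
      then obtain X Y where "W = X @ b # Y" "a \<in> set X" using Cons.IH by blast
      then have "w # W = (w # X) @ b # Y" "a \<in> set (w # X)" by simp_all
      then show ?thesis by blast
    qed
  qed simp
  then show thesis using that by blast
qed

lemma contains_123_iff:
  "contains_pattern w [1, 2, 3] \<longleftrightarrow> (\<exists>a b c. subseq [a, b, c] w \<and> a < b \<and> b < c)"
proof
  assume "contains_pattern w [1, 2, 3]"
  then obtain ys where ys: "subseq ys w" "order_iso ys [1, 2, 3]"
    by (auto simp: contains_pattern_def)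
  then obtain a b c where "ys = [a, b, c]"
    by (auto simp: order_iso_def length_Suc_conv)
  moreover from this ys(2) have "a < b" "b < c"
    by (auto simp: order_iso_def nth_Cons' all_less_Suc_conv)
  ultimately show "\<exists>a b c. subseq [a, b, c] w \<and> a < b \<and> b < c"
    using ys(1) by blast
next
  assume "\<exists>a b c. subseq [a, b, c] w \<and> a < b \<and> b < c"
  then obtain a b c where abc: "subseq [a, b, c] w" "a < b" "b < c" by blast
  then have "order_iso [a, b, c] [1, 2, 3]"
    by (auto simp: order_iso_def nth_Cons' less_Suc_eq)
  with abc show "contains_pattern w [1, 2, 3]"
    by (auto simp: contains_pattern_def)
qed

lemma contains_21_iff: "contains_pattern w [2, 1] \<longleftrightarrow> \<not> sorted w"
proof
  assume "contains_pattern w [2, 1]"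
  then obtain ys where ys: "subseq ys w" "order_iso ys [2, 1]"
    by (auto simp: contains_pattern_def)
  then obtain a b where "ys = [a, b]"
    by (auto simp: order_iso_def length_Suc_conv)
  moreover from this ys(2) have "b < a"
    by (auto simp: order_iso_def nth_Cons' all_less_Suc_conv)
  ultimately show "\<not> sorted w"
    using ys(1) by (auto simp: sorted_wrt_iff_subseq not_le)
next
  assume "\<not> sorted w"
  then obtain a b where "subseq [a, b] w" "b < a"
    by (auto simp: sorted_wrt_iff_subseq not_le)
  moreover from this have "order_iso [a, b] [2, 1]"
    by (auto simp: order_iso_def nth_Cons' less_Suc_eq)
  ultimately show "contains_pattern w [2, 1]"
    by (auto simp: contains_pattern_def)
qed

section \<open>The 123-stack\<close>

text \<open>
  Pushing \<open>x\<close> on a 123-avoiding stack \<open>st\<close> creates a 123 exactly if \<open>st\<close> has two letters above \<open>x\<close> that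
  ascend from top to bottom. The condition refers to the old stack only and is monotone in it, which
  makes it easier to handle than containment in the new stack.
\<close>

fun pair_above :: "nat \<Rightarrow> nat list \<Rightarrow> bool" where
  "pair_above x [] \<longleftrightarrow> False"
| "pair_above x (t # st) \<longleftrightarrow> x < t \<and> (\<exists>b\<in>set st. t < b) \<or> pair_above x st"

text \<open>
  The 123-stack with the popping rule expressed by \<open>pair_above\<close>. It agrees with the pattern-avoiding machine
  on 123-avoiding stacks, and its laws hold for arbitrary stacks.
\<close>

fun run123 :: "nat list \<Rightarrow> nat list \<Rightarrow> nat list" where
  "run123 st [] = st"
| "run123 [] (x # xs) = run123 [x] xs"
| "run123 (t # st) (x # xs) =
     (if pair_above x (t # st) then t # run123 st (x # xs) else run123 (x # t # st) xs)"

lemma pair_above_iff: "pair_above x st \<longleftrightarrow> (\<exists>a b. subseq [a, b] st \<and> x < a \<and> a < b)"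
proof (induction st)
  case (Cons t st)
  then show ?case by (simp add: subseq_pair_Cons del: subseq_Cons2_iff subseq_Cons2_neq; blast)
qed simp

lemma pair_above_append:
  "pair_above x (U @ D) \<longleftrightarrow>
     pair_above x U \<or> pair_above x D \<or> (\<exists>t\<in>set U. x < t \<and> (\<exists>b\<in>set D. t < b))"
  by (induction U) auto

lemma decreasing_no_pair: "sorted_wrt (\<ge>) D \<Longrightarrow> \<not> pair_above x D"
  by (induction D) (auto simp: leD)

lemma contains_123_Cons:
  assumes "\<not> contains_pattern st [1, 2, 3]"
  shows "contains_pattern (x # st) [1, 2, 3] \<longleftrightarrow> pair_above x st"
proof -
  have "subseq [a, b, c] (x # st) \<longleftrightarrow> (a = x \<and> subseq [b, c] st) \<or> subseq [a, b, c] st" for a b c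
    by (auto dest: subseq_Cons')
  then have "contains_pattern (x # st) [1, 2, 3] \<longleftrightarrow>
      contains_pattern st [1, 2, 3] \<or> (\<exists>b c. subseq [b, c] st \<and> x < b \<and> b < c)"
    unfolding contains_123_iff by (simp only:) metis
  with assms show ?thesis
    by (simp only: pair_above_iff simp_thms)
qed

lemma stack_run_eq_run123:
  "\<not> contains_pattern st [1, 2, 3] \<Longrightarrow> stack_run [1, 2, 3] st xs = run123 st xs"
proof (induction st xs rule: run123.induct)
  case (2 x xs)
  have "\<not> contains_pattern [x] [1, 2, 3]" by (simp add: contains_123_iff del: One_nat_def)
  with 2 show ?case by simp
next
  case (3 t st x xs)
  have "\<not> contains_pattern st [1, 2, 3]"
    using 3(3) unfolding contains_123_iff by blast
  show ?case
  proof (cases "pair_above x (t # st)")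
    case True
    with 3 \<open>\<not> contains_pattern st [1, 2, 3]\<close> show ?thesis
      by (simp add: contains_123_Cons del: One_nat_def pair_above.simps)
  next
    case False
    with 3(3) have "\<not> contains_pattern (x # t # st) [1, 2, 3]"
      by (simp add: contains_123_Cons del: One_nat_def pair_above.simps)
    with False 3(2) show ?thesis
      by (simp del: One_nat_def pair_above.simps)
  qed
qed simp

lemma S123_eq: "\<S> [1, 2, 3] p = run123 [] p"
  by (simp add: stack_map_def stack_run_eq_run123 contains_123_iff del: One_nat_def)

lemma run123_push: "\<not> pair_above x st \<Longrightarrow> run123 st (x # xs) = run123 (x # st) xs"
  by (cases st) auto

text \<open>
  An ascending pair deep in the stack stays there while the letters above it are popped, so all of these go.
\<close>

lemma run123_pops: "pair_above x st \<Longrightarrow> run123 (U @ st) (x # xs) = U @ run123 st (x # xs)"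
proof (induction U)
  case (Cons u U)
  have "pair_above x (u # U @ st)" using Cons.prems by (induction U) auto
  with Cons show ?case by simp
qed simp

lemma mset_run123: "mset (run123 st xs) = mset st + mset xs"
  by (induction st xs rule: run123.induct) auto

text \<open>
  Letters that are together in the stack leave it from top to bottom.
\<close>

lemma subseq_run123: "subseq st (run123 st xs)"
proof (induction st xs rule: run123.induct)
  case (3 t st x xs)
  then show ?case by (auto dest: subseq_Cons')
qed auto

text \<open>
  The letters of \<open>E\<close> that are already in the stack are below the incoming one, so they take no part in a pair
  above it.
\<close>

lemma run123_push_ascending:
  "sorted_wrt (<) E \<Longrightarrow> \<forall>e\<in>set E. \<not> pair_above e st \<Longrightarrow> run123 st (E @ F) = run123 (rev E @ st) F"
proof (induction E arbitrary: st)
  case (Cons e E)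
  then have "run123 st ((e # E) @ F) = run123 (e # st) (E @ F)" by (simp add: run123_push)
  also have "\<dots> = run123 (rev E @ e # st) F"
    using Cons.prems by (intro Cons.IH) auto
  finally show ?case by simp
qed simp

text \<open>
  Each pop needs a pair above the incoming letter. Once only \<open>D\<close> is left there is no such pair, so \<open>D\<close> is
  never touched before the input is exhausted.
\<close>

lemma run123_base:
  "\<forall>x\<in>set ys. \<not> pair_above x D \<Longrightarrow> \<exists>W. run123 (U @ D) ys = W @ D"
proof (induction ys arbitrary: U)
  case (Cons x ys)
  note outer = Cons.IH and prems = Cons.prems
  show ?case
  proof (induction U)
    case Nil
    then show ?case using Cons.IH[of "[x]"] Cons.prems by (simp add: run123_push)
  next
    case (Cons u U)
    show ?case
    proof (cases "pair_above x ((u # U) @ D)")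
      case True
      with Cons show ?thesis by auto
    next
      case False
      then show ?thesis using outer[of "x # u # U"] prems by (simp add: run123_push del: run123.simps)
    qed
  qed
qed simp

text \<open>
  The lowest letter above \<open>D\<close> stays below the top of \<open>D\<close>: it can only be popped by a letter smaller than
  itself, which then takes its place. When the minimum \<open>m\<close> arrives, that lowest letter and the top of \<open>D\<close> are
  a pair above \<open>m\<close>, so everything above \<open>D\<close> is popped. The hypothesis \<open>low\<close> is this invariant; for empty
  \<open>U\<close> the next letter to arrive takes over the role of the lowest letter.
\<close>

lemma run123_min_pushed:
  assumes D: "sorted_wrt (\<ge>) D" "D \<noteq> []"
    and min: "\<forall>x\<in>set U \<union> set X \<union> set D. m < x"
    and low: "if U = [] then hd (X @ [m]) < hd D else last U < hd D"
  shows "\<exists>P. run123 (U @ D) (X @ m # Y) = P @ run123 (m # D) Y"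
  using min low
proof (induction X arbitrary: U)
  case Nil
  show ?case
  proof (cases U rule: rev_cases)
    case Nil
    then show ?thesis using D by (intro exI[of _ "[]"]) (simp add: run123_push decreasing_no_pair)
  next
    case (snoc U' u)
    have "pair_above m (u # D)" using Nil snoc D by (cases D) auto
    then have "run123 (U @ D) ([] @ m # Y) = U' @ u # run123 D (m # Y)"
      using snoc run123_pops[of m "u # D" U' Y] by simp
    then show ?thesis using D by (intro exI[of _ U]) (simp add: snoc run123_push decreasing_no_pair)
  qed
next
  case (Cons x X)
  note outer = Cons.IH
  show ?case
    using Cons.prems
  proof (induction U)
    case Nil
    then show ?case using outer[of "[x]"] D by (simp add: run123_push decreasing_no_pair)
  next
    case (Cons u U)
    show ?case
    proof (cases "pair_above x ((u # U) @ D)")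
      case True
      have "U = [] \<Longrightarrow> x < hd D" using True Cons.prems(2) decreasing_no_pair[OF D(1)] by auto
      then have "\<exists>P. run123 (U @ D) ((x # X) @ m # Y) = P @ run123 (m # D) Y"
        using Cons.prems by (intro Cons.IH) auto
      with True show ?thesis by (auto intro: exI[of _ "u # _"])
    next
      case False
      then show ?thesis
        using outer[of "x # u # U"] Cons.prems by (auto simp: run123_push)
    qed
  qed
qed

text \<open>
  Under \<open>m\<close> and \<open>D = rev E\<close> there is no pair above any later letter, as \<open>m\<close> is minimal and \<open>D\<close> decreases.
  So \<open>m # D\<close> is itself a base that survives until the end.
\<close>

lemma run123_before_min:
  assumes p: "p = E @ F" "sorted_wrt (<) E" "E \<noteq> []" "F = [] \<or> hd F < last E"
    and m: "m \<in> set F" "\<forall>x\<in>set E. m < x" "\<forall>x\<in>set F. m \<le> x" "distinct F"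
  shows "\<exists>W. run123 [] p = W @ m # rev E"
proof -
  obtain X Y where F: "F = X @ m # Y" using m(1) by (auto dest: split_list)
  have D: "sorted_wrt (\<ge>) (rev E)"
    using p(2) by (auto simp: sorted_wrt_rev elim: sorted_wrt_mono_rel[rotated])
  have "run123 [] p = run123 (rev E) F"
    using run123_push_ascending[OF p(2), of "[]" F] p(1) by simp
  also obtain P where "run123 (rev E) F = P @ run123 (m # rev E) Y"
  proof -
    have "\<exists>P. run123 ([] @ rev E) (X @ m # Y) = P @ run123 (m # rev E) Y"
    proof (rule run123_min_pushed[OF D])
      show "if [] = [] then hd (X @ [m]) < hd (rev E) else last [] < hd (rev E)"
        using p(3,4) unfolding F by (cases X) (auto simp: hd_rev)
      show "\<forall>x\<in>set [] \<union> set X \<union> set (rev E). m < x"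
        using m unfolding F by (auto simp: le_less)
    qed (use p in simp)
    then show ?thesis using that F by auto
  qed
  also obtain W where "run123 (m # rev E) Y = W @ m # rev E"
  proof -
    have "\<forall>x\<in>set Y. \<not> pair_above x (m # rev E)"
      using m(3) decreasing_no_pair[OF D] unfolding F by (auto simp: leD)
    then show ?thesis using run123_base[of Y "m # rev E" "[]"] that by auto
  qed
  finally show ?thesis by auto
qed

section \<open>First ascending runs\<close>

fun asc_run :: "nat list \<Rightarrow> nat list" where
  "asc_run [] = []"
| "asc_run [x] = [x]"
| "asc_run (x # y # ys) = (if x < y then x # asc_run (y # ys) else [x])"

definition asc_rest :: "nat list \<Rightarrow> nat list" where
  "asc_rest xs = drop (length (asc_run xs)) xs"

text \<open>
  This is the uniqueness of the decomposition into the first ascending run and the rest.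
\<close>

lemma asc_run_append:
  "sorted_wrt (<) A \<Longrightarrow> F = [] \<or> A \<noteq> [] \<and> hd F \<le> last A \<Longrightarrow> asc_run (A @ F) = A"
proof (induction A rule: asc_run.induct)
  case (2 x)
  then show ?case by (cases F) auto
qed auto

lemma asc_run_split:
  "asc_run xs @ asc_rest xs = xs"
  "sorted_wrt (<) (asc_run xs)"
  "xs \<noteq> [] \<Longrightarrow> asc_run xs \<noteq> [] \<and> hd (asc_run xs) = hd xs"
  "asc_rest xs = [] \<or> asc_run xs \<noteq> [] \<and> hd (asc_rest xs) \<le> last (asc_run xs)"
proof -
  show ne: "xs \<noteq> [] \<Longrightarrow> asc_run xs \<noteq> [] \<and> hd (asc_run xs) = hd xs" for xs
    by (induction xs rule: asc_run.induct) auto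
  show "asc_run xs @ asc_rest xs = xs"
    by (induction xs rule: asc_run.induct) (auto simp: asc_rest_def)
  show "asc_rest xs = [] \<or> asc_run xs \<noteq> [] \<and> hd (asc_rest xs) \<le> last (asc_run xs)"
  proof (induction xs rule: asc_run.induct)
    case (3 x y ys)
    then show ?case using ne[of "y # ys"] by (auto simp: asc_rest_def)
  qed (auto simp: asc_rest_def)
  show "sorted_wrt (<) (asc_run xs)"
  proof (induction xs rule: asc_run.induct)
    case (3 x y ys)
    then show ?case using ne[of "y # ys"] by (cases "asc_run (y # ys)") (auto dest: less_trans)
  qed auto
qed

lemma asc_rest_distinct:
  assumes "distinct xs"
  shows "asc_rest xs = [] \<or> asc_run xs \<noteq> [] \<and> hd (asc_rest xs) < last (asc_run xs)"
proof (cases "asc_rest xs = []")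
  case False
  then have ne: "asc_run xs \<noteq> []" and le: "hd (asc_rest xs) \<le> last (asc_run xs)"
    using asc_run_split(4)[of xs] by auto
  have "distinct (asc_run xs @ asc_rest xs)"
    using assms by (simp add: asc_run_split(1))
  then have "hd (asc_rest xs) \<noteq> last (asc_run xs)"
    using hd_in_set[OF False] last_in_set[OF ne] by auto
  with ne le show ?thesis by simp
qed simp

section \<open>The 12-stack and the Catalan numbers\<close>

text \<open>
  The stack that avoids 12 from top to bottom: as its content decreases from top to bottom, a letter
  creates a 12 exactly if it is smaller than the top.
\<close>

fun run12 :: "nat list \<Rightarrow> nat list \<Rightarrow> nat list" where
  "run12 st [] = st"
| "run12 [] (x # xs) = run12 [x] xs"
| "run12 (t # st) (x # xs) = (if x < t then t # run12 st (x # xs) else run12 (x # t # st) xs)"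

lemma mset_run12: "mset (run12 st xs) = mset st + mset xs"
  by (induction st xs rule: run12.induct) auto

lemma run12_push_ascending:
  "sorted_wrt (<) E \<Longrightarrow> st = [] \<or> E = [] \<or> hd st < hd E \<Longrightarrow> run12 st (E @ F) = run12 (rev E @ st) F"
proof (induction E arbitrary: st)
  case (Cons e E)
  then have "run12 st ((e # E) @ F) = run12 (e # st) (E @ F)" by (cases st) auto
  also have "\<dots> = run12 (rev E @ e # st) F"
  proof (rule Cons.IH)
    show "e # st = [] \<or> E = [] \<or> hd (e # st) < hd E"
      using Cons.prems(1) by (cases E) auto
  qed (use Cons.prems in simp)
  finally show ?case by simp
qed simp

text \<open>
  The minimum \<open>m\<close> empties the stack, and whatever comes before it in the input comes out first.
\<close>

lemma run12_min_split:
  "\<forall>x\<in>set st \<union> set L. m < x \<Longrightarrow> run12 st (L @ m # R) = run12 st L @ run12 [m] R"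
proof (induction st L rule: run12.induct)
  case (1 st)
  then show ?case by (induction st) auto
qed auto

text \<open>
  At the bottom of the stack, a letter smaller than all others is never popped.
\<close>

lemma run12_min_bottom:
  "\<forall>x\<in>set st \<union> set R. m < x \<Longrightarrow> run12 (st @ [m]) R = run12 st R @ [m]"
  by (induction st R rule: run12.induct) auto

text \<open>
  As the stack only permutes its input, these are the arrangements of \<open>{a..<b}\<close> that the 12-stack turns into a
  decreasing list.
\<close>

definition sortable12 :: "nat \<Rightarrow> nat \<Rightarrow> nat list set" where
  "sortable12 a b = {s. run12 [] s = rev [a..<b]}"

lemma sortable12_set: "s \<in> sortable12 a b \<Longrightarrow> set s = {a..<b} \<and> distinct s \<and> length s = b - a"
proof -
  assume "s \<in> sortable12 a b"
  then have *: "mset s = mset [a..<b]"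
    using mset_run12[of "[]" s] by (simp add: sortable12_def)
  then show ?thesis
    using mset_eq_setD[OF *] mset_eq_imp_distinct_iff[OF *] mset_eq_length[OF *] by auto
qed

lemma upt_split: "a \<le> b \<Longrightarrow> b \<le> c \<Longrightarrow> [a..<c] = [a..<b] @ [b..<c]"
  using upt_add_eq_append[of a b "c - b"] by simp

text \<open>
  The output for \<open>L @ a # R\<close> consists of the outputs for \<open>L\<close> and \<open>R\<close>, followed by \<open>a\<close>. It decreases exactly
  if both outputs do and all letters of \<open>L\<close> exceed those of \<open>R\<close>, that is, if \<open>R\<close> uses an interval
  \<open>{Suc a..<c}\<close> and \<open>L\<close> uses \<open>{c..<b}\<close>.
\<close>

lemma sortable12_rec:
  assumes "a < b"
  shows "bij_betw (\<lambda>(L, R). L @ a # R) (\<Union>c\<in>{Suc a..b}. sortable12 c b \<times> sortable12 (Suc a) c) (sortable12 a b)"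
  (is "bij_betw ?f ?P _")
proof (rule bij_betw_imageI)
  show "inj_on ?f ?P"
  proof (rule inj_onI, clarify)
    fix L R L' R' c c'
    assume "c \<in> {Suc a..b}" "L \<in> sortable12 c b" "R \<in> sortable12 (Suc a) c"
      "c' \<in> {Suc a..b}" "L' \<in> sortable12 c' b" "R' \<in> sortable12 (Suc a) c'"
    then have "a \<notin> set L" "a \<notin> set R" "a \<notin> set L'" "a \<notin> set R'"
      by (auto dest!: sortable12_set)
    moreover assume "L @ a # R = L' @ a # R'"
    ultimately show "L = L' \<and> R = R'" by (simp add: append_Cons_eq_iff)
  qed
  show "?f ` ?P = sortable12 a b"
  proof (intro equalityI subsetI)
    fix s assume "s \<in> ?f ` ?P"
    then obtain c L R where c: "c \<in> {Suc a..b}" and LR: "L \<in> sortable12 c b" "R \<in> sortable12 (Suc a) c"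
      and s: "s = L @ a # R" by auto
    have "\<forall>x\<in>set L. a < x" "\<forall>x\<in>set R. a < x"
      using sortable12_set[OF LR(1)] sortable12_set[OF LR(2)] c by auto
    then have "run12 [] s = run12 [] L @ run12 [] R @ [a]"
      using run12_min_split[of "[]" L a R] run12_min_bottom[of "[]" R a] s by simp
    also have "\<dots> = rev ([a] @ [Suc a..<c] @ [c..<b])"
      using LR by (simp add: sortable12_def)
    also have "[a] @ [Suc a..<c] @ [c..<b] = [a..<b]"
      using c upt_conv_Cons[of a c] upt_split[of a c b] by simp
    finally show "s \<in> sortable12 a b" by (simp add: sortable12_def)
  next
    fix s assume s: "s \<in> sortable12 a b"
    then have set_s: "set s = {a..<b}" "distinct s" "length s = b - a" by (auto dest: sortable12_set)
    then obtain L R where LR: "s = L @ a # R" using assms by (metis atLeastLessThan_iff le_refl split_list)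
    define c where "c = Suc a + length R"
    have c: "Suc a \<le> c" "c \<le> b" using set_s(3) assms by (auto simp: LR c_def)
    have "\<forall>x\<in>set L \<union> set R. a \<le> x \<and> a \<noteq> x" using set_s(1,2) by (auto simp: LR)
    then have "\<forall>x\<in>set L. a < x" "\<forall>x\<in>set R. a < x" by (auto simp: le_less)
    then have "run12 [] s = run12 [] L @ run12 [] R @ [a]"
      using run12_min_split[of "[]" L a R] run12_min_bottom[of "[]" R a] LR by simp
    moreover have "run12 [] s = rev [a..<b]" using s by (simp add: sortable12_def)
    moreover have "[a..<b] = [a] @ [Suc a..<c] @ [c..<b]"
      using c upt_conv_Cons[of a c] upt_split[of a c b] by simp
    ultimately have "run12 [] L @ run12 [] R = rev [c..<b] @ rev [Suc a..<c]"
      by simp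
    moreover have "length (run12 [] R) = length R"
      using mset_run12[of "[]" R] mset_eq_length by fastforce
    moreover have "length (rev [Suc a..<c]) = length R" by (simp add: c_def del: upt_Suc)
    ultimately have "run12 [] L = rev [c..<b]" "run12 [] R = rev [Suc a..<c]"
      by (metis append_eq_append_conv)+
    with c LR show "s \<in> ?f ` ?P"
      by (intro image_eqI[of _ _ "(L, R)"]) (auto simp: sortable12_def)
  qed
qed

definition catalan :: "nat \<Rightarrow> real" where
  "catalan n = real ((2 * n) choose n) / real (n + 1)"

lemma catalan_Suc: "real (n + 2) * catalan (Suc n) = real (4 * n + 2) * catalan n"
proof -
  have c: "real ((2 * m) choose m) = fact (2 * m) / (fact m * fact m)" for m
    by (simp add: binomial_fact)
  have "fact (2 * Suc n) = (real (2 * n + 2) * real (2 * n + 1)) * fact (2 * n)"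
    by (simp add: algebra_simps)
  moreover have "fact (Suc n) = real (n + 1) * fact n" by simp
  ultimately have "real ((2 * Suc n) choose Suc n) =
      (real (2 * n + 2) * real (2 * n + 1)) * fact (2 * n) / ((real (n + 1) * fact n) * (real (n + 1) * fact n))"
    unfolding c by metis
  also have "\<dots> = (real (2 * n + 2) * real (2 * n + 1)) / (real (n + 1) * real (n + 1)) * real ((2 * n) choose n)"
    unfolding c by simp
  also have "\<dots> = real (4 * n + 2) / real (n + 1) * real ((2 * n) choose n)"
  proof -
    have "real (2 * n + 2) * real (2 * n + 1) = real (n + 1) * real (4 * n + 2)"
      by (simp add: algebra_simps)
    then show ?thesis by (simp del: of_nat_add of_nat_Suc)
  qed
  finally show ?thesis
    unfolding catalan_def by simp
qed

text \<open>
  The Catalan convolution follows from the two-term recursion by induction. With \<open>S m\<close> the convolution sum and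
  \<open>T m\<close> the same sum weighted by \<open>i\<close>, the symmetry \<open>i \<mapsto> m - i\<close> gives \<open>2 T m = m S m\<close>. Applying the two-term
  recursion to the terms of \<open>T (n + 1) + S (n + 1)\<close> with \<open>i > 0\<close> turns their sum into \<open>4 T n + 2 S n\<close>. Eliminating
  \<open>T\<close> and inserting the induction hypothesis for \<open>S n\<close> shows that \<open>S (n + 1)\<close> satisfies the two-term recursion.
\<close>

lemma catalan_convolution: "(\<Sum>i\<le>n. catalan i * catalan (n - i)) = catalan (Suc n)"
proof (induction n)
  case 0
  show ?case by (simp add: catalan_def)
next
  case (Suc n)
  define S where "S m = (\<Sum>i\<le>m. catalan i * catalan (m - i))" for m
  define T where "T m = (\<Sum>i\<le>m. real i * (catalan i * catalan (m - i)))" for m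
  have T: "2 * T m = real m * S m" for m
  proof -
    have "T m = (\<Sum>i\<le>m. real (m - i) * (catalan i * catalan (m - i)))"
      unfolding T_def
      by (rule sum.reindex_bij_witness[of _ "\<lambda>i. m - i" "\<lambda>i. m - i"]) auto
    then have "T m + T m = (\<Sum>i\<le>m. real i * (catalan i * catalan (m - i))) + (\<Sum>i\<le>m. real (m - i) * (catalan i * catalan (m - i)))"
      by (simp only: T_def)
    then have "2 * T m = (\<Sum>i\<le>m. (real i + real (m - i)) * (catalan i * catalan (m - i)))"
      by (simp only: mult_2 sum.distrib distrib_right)
    also have "\<dots> = (\<Sum>i\<le>m. real m * (catalan i * catalan (m - i)))"
      by (intro sum.cong) auto
    finally show ?thesis by (simp add: S_def sum_distrib_left)
  qed
  have "T (Suc n) + S (Suc n) = (\<Sum>i\<le>Suc n. real (i + 1) * catalan i * catalan (Suc n - i))"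
    by (simp add: T_def S_def sum.distrib[symmetric] algebra_simps del: sum.atMost_Suc)
  also have "\<dots> = catalan 0 * catalan (Suc n) + (\<Sum>i\<le>n. real (i + 2) * catalan (Suc i) * catalan (n - i))"
    by (simp add: sum.atMost_Suc_shift del: sum.atMost_Suc)
  also have "(\<Sum>i\<le>n. real (i + 2) * catalan (Suc i) * catalan (n - i)) = (\<Sum>i\<le>n. real (4 * i + 2) * catalan i * catalan (n - i))"
    unfolding catalan_Suc ..
  also have "\<dots> = 4 * T n + 2 * S n"
    by (simp add: T_def S_def sum.distrib sum_distrib_left algebra_simps)
  finally have "T (Suc n) + S (Suc n) = catalan (Suc n) + 4 * T n + 2 * S n"
    by (simp add: catalan_def[of 0])
  moreover have "S n = catalan (Suc n)" using Suc by (simp add: S_def)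
  ultimately have "real (n + 3) * S (Suc n) = real (4 * n + 6) * catalan (Suc n)"
    using T[of n] T[of "Suc n"] by (simp add: algebra_simps)
  also have "\<dots> = real (n + 3) * catalan (Suc (Suc n))"
    using catalan_Suc[of "Suc n"] by (simp add: algebra_simps)
  finally show ?case by (simp add: S_def del: sum.atMost_Suc)
qed

lemma card_sortable12: "finite (sortable12 a (a + m)) \<and> real (card (sortable12 a (a + m))) = catalan m"
proof (induction m arbitrary: a rule: less_induct)
  case (less m)
  show ?case
  proof (cases m)
    case 0
    have "sortable12 a a = {[]}"
      using sortable12_set[of _ a a] by (auto simp: sortable12_def)
    then show ?thesis by (simp add: 0 catalan_def)
  next
    case (Suc n)
    let ?P = "\<lambda>c. sortable12 c (a + m) \<times> sortable12 (Suc a) c"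
    have *: "finite (sortable12 (Suc a + i) (a + m)) \<and> real (card (sortable12 (Suc a + i) (a + m))) = catalan (n - i)"
      "finite (sortable12 (Suc a) (Suc a + i)) \<and> real (card (sortable12 (Suc a) (Suc a + i))) = catalan i"
      if "i \<le> n" for i
      using less[of "n - i" "Suc a + i"] less[of i "Suc a"] that by (auto simp: Suc)
    have img: "{Suc a..a + m} = (\<lambda>i. Suc a + i) ` {..n}"
      by (auto simp: Suc image_iff Bex_def) presburger
    have fin: "finite (?P c)" if "c \<in> {Suc a..a + m}" for c
      using that * unfolding img by auto
    have disj: "?P c \<inter> ?P d = {}" if "c \<in> {Suc a..a + m}" "d \<in> {Suc a..a + m}" "c \<noteq> d" for c d
      using that by (auto dest!: sortable12_set)
    have bij: "bij_betw (\<lambda>(L, R). L @ a # R) (\<Union>c\<in>{Suc a..a + m}. ?P c) (sortable12 a (a + m))"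
      using sortable12_rec[of a "a + m"] Suc by simp
    then have "card (sortable12 a (a + m)) = card (\<Union>c\<in>{Suc a..a + m}. ?P c)"
      by (simp add: bij_betw_same_card)
    also have "\<dots> = (\<Sum>c\<in>{Suc a..a + m}. card (?P c))"
      using fin disj by (intro card_UN_disjoint) auto
    also have "\<dots> = (\<Sum>i\<le>n. card (?P (Suc a + i)))"
      unfolding img by (subst sum.reindex) auto
    finally have "real (card (sortable12 a (a + m))) = (\<Sum>i\<le>n. catalan i * catalan (n - i))"
      using * by (auto simp: card_cartesian_product mult.commute intro!: sum.cong)
    moreover have "finite (sortable12 a (a + m))"
      using bij_betw_finite[OF bij] fin by blast
    ultimately show ?thesis by (simp add: catalan_convolution Suc)
  qed
qed

section \<open>Small and large letters above a decreasing base\<close>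

text \<open>
  If all letters above \<open>D\<close> are smaller than its top, each of them forms an ascending pair with that top.
  So an incoming letter pops exactly the larger letters, as in the 12-stack.
\<close>

lemma run123_below_base:
  assumes D: "sorted_wrt (\<ge>) D" "D \<noteq> []"
    and "sorted_wrt (\<ge>) U" "\<forall>x\<in>set U \<union> set ys. x < hd D"
  shows "run123 (U @ D) ys = run12 U ys @ D"
  using assms(3,4)
proof (induction U ys rule: run12.induct)
  case (2 x xs)
  then show ?case using D by (simp add: run123_push decreasing_no_pair)
next
  case (3 t st x xs)
  have "hd D \<in> set D" using D by simp
  then have *: "pair_above x ((t # st) @ D) \<longleftrightarrow> x < t"
    using 3(3,4) decreasing_no_pair[OF D(1)] decreasing_no_pair[OF 3(3)]
    unfolding pair_above_append by fastforce
  show ?case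
  proof (cases "x < t")
    case True
    with * 3 show ?thesis by simp
  next
    case False
    with 3(3) have "sorted_wrt (\<ge>) (x # t # st)" by auto
    with False * 3 show ?thesis by (simp add: run123_push del: run123.simps)
  qed
qed simp

text \<open>
  The small letters \<open>A\<close> and the large letters \<open>B\<close> are pushed without pops. The next letter, if there is one,
  is smaller than the last letter of \<open>A\<close>, which together with the top of \<open>D\<close> is a pair lying below \<open>B\<close>.
  So \<open>B\<close> leaves the stack at once and the small letters continue as if it had never been there.
\<close>

lemma run123_insert_large:
  assumes A: "sorted_wrt (<) A" and B: "sorted_wrt (<) B" and D: "sorted_wrt (\<ge>) D" "D \<noteq> []"
    and small: "\<forall>x\<in>set A \<union> set F. x < hd D" and big: "\<forall>b\<in>set B. hd D < b"
    and F: "F = [] \<or> A \<noteq> [] \<and> hd F < last A"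
  shows "run123 D (A @ B @ F) = rev B @ run12 [] (A @ F) @ D"
proof -
  have "sorted_wrt (<) (A @ B)"
    unfolding sorted_wrt_append using A B small big by (meson UnI1 less_trans)
  then have "run123 D ((A @ B) @ F) = run123 (rev (A @ B) @ D) F"
    using D(1) by (intro run123_push_ascending) (auto simp: decreasing_no_pair)
  also have "\<dots> = rev B @ run123 (rev A @ D) F"
  proof (cases F)
    case (Cons f F')
    then have "last A \<in> set (rev A)" "f < last A" "last A < hd D" "hd D \<in> set D"
      using F small D(2) by auto
    then have "pair_above f (rev A @ D)"
      unfolding pair_above_append by blast
    then show ?thesis
      using run123_pops Cons by simp
  qed simp
  also have "run123 (rev A @ D) F = run12 (rev A) F @ D"
    using A small by (intro run123_below_base D) (auto simp: sorted_wrt_rev elim: sorted_wrt_mono_rel[rotated])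
  also have "run12 (rev A) F = run12 [] (A @ F)"
    using A by (simp add: run12_push_ascending)
  finally show ?thesis by simp
qed

text \<open>
  The first ascending run \<open>E\<close> of \<open>ys\<close> consists of small letters \<open>A\<close> and then large letters \<open>B'\<close>, all pushed
  without pops. Let \<open>f\<close> be the letter after \<open>E\<close>. If \<open>B'\<close> is not empty and \<open>f\<close> were pushed on top of \<open>B'\<close>, then
  \<open>f\<close> would precede the larger letter \<open>last E\<close> in the output, contrary to its form. So the
  stack contains an ascending pair of letters larger than \<open>f\<close>. It consists of a letter of \<open>A\<close> and one of \<open>D\<close>, because \<open>rev B' @ rev A\<close> and \<open>D\<close> decrease and \<open>B'\<close> exceeds \<open>D\<close>;
  hence \<open>f < last A\<close>. For empty \<open>B'\<close> this is clear. Then exactly \<open>B'\<close> and the small letter \<open>last A\<close> are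
  popped first, so \<open>B'\<close> is the whole initial block of large letters in the output.
\<close>

lemma run123_insert_large_converse:
  assumes D: "sorted_wrt (\<ge>) D" "D \<noteq> []" and ys: "ys \<noteq> []" "hd ys < hd D" "distinct ys"
    and B: "sorted_wrt (<) B" and big: "\<forall>b\<in>set B. hd D < b" and small: "\<forall>s\<in>set S. s < hd D"
    and run: "run123 D ys = rev B @ S @ D"
  shows "\<exists>A F. ys = A @ B @ F \<and> sorted_wrt (<) A \<and> (F = [] \<or> A \<noteq> [] \<and> hd F < last A)"
proof -
  define E where "E = asc_run ys"
  define F where "F = asc_rest ys"
  define A where "A = takeWhile (\<lambda>x. x < hd D) E"
  define B' where "B' = dropWhile (\<lambda>x. x < hd D) E"
  have ysEF: "ys = E @ F" and E: "sorted_wrt (<) E" "E \<noteq> []" "hd E < hd D"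
    and F: "F = [] \<or> hd F < last E"
    using asc_run_split[of ys] asc_rest_distinct[of ys] ys by (auto simp: E_def F_def)
  have EAB: "E = A @ B'" by (simp add: A_def B'_def)
  have "A \<noteq> []" using E(2,3) by (cases E) (auto simp: A_def)
  have A: "\<forall>a\<in>set A. a < hd D" by (auto simp: A_def dest: set_takeWhileD)
  have "last A < hd D" using A \<open>A \<noteq> []\<close> by simp
  have D_le: "\<forall>d\<in>set D. d \<le> hd D" using D by (cases D) auto
  have "mset ys + mset D = mset (rev B @ S @ D)"
    unfolding run[symmetric] mset_run123 by simp
  then have "mset ys = mset (B @ S)" by simp
  then have set_ys: "set ys = set B \<union> set S" by (metis set_append set_mset_mset)
  have B': "\<forall>b\<in>set B'. hd D < b"
  proof
    fix b assume b: "b \<in> set B'"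
    then have "hd B' \<le> b" using E(1) unfolding EAB by (cases B') (auto simp: sorted_wrt_append)
    moreover have "\<not> hd B' < hd D"
      using b hd_dropWhile[of "\<lambda>x. x < hd D" E] unfolding B'_def by (metis empty_iff empty_set)
    ultimately have "hd D \<le> b" by simp
    moreover have "b \<in> set B \<union> set S" using b set_ys ysEF EAB by auto
    ultimately show "hd D < b" using big small by force
  qed
  have run': "run123 D ys = run123 (rev B' @ rev A @ D) F"
    using run123_push_ascending[OF E(1), of D F] D(1)
    by (simp add: ysEF decreasing_no_pair) (simp add: EAB)
  \<comment> \<open>cutting the output off at the first letter that is not large identifies the block of large letters\<close>
  have split: "takeWhile (\<lambda>x. hd D < x) (rev X @ Y) = rev X"
    if "\<forall>x\<in>set X. hd D < x" "Y = [] \<or> \<not> hd D < hd Y" for X Y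
    using that by (cases Y) (auto simp: takeWhile_append)
  have *: "takeWhile (\<lambda>x. hd D < x) (run123 D ys) = rev B"
    unfolding run using small D(2) by (intro split big) (cases S; auto)
  show ?thesis
  proof (cases F)
    case Nil
    have "run123 D ys = rev B' @ rev A @ D" by (simp add: run' Nil)
    then have "rev B = rev B'"
      using * split[OF B', of "rev A @ D"] \<open>last A < hd D\<close> \<open>A \<noteq> []\<close> by (simp add: hd_append hd_rev)
    then show ?thesis
      using ysEF EAB Nil E(1) by (intro exI[of _ A] exI[of _ F]) (auto simp: sorted_wrt_append)
  next
    case (Cons f F')
    then have f: "f < last E" using F by simp
    have "f < last A"
    proof (cases "B' = []")
      case False
      then have lastE: "last E = last B'" by (simp add: EAB)
      have "pair_above f (rev B' @ rev A @ D)"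
      proof (rule ccontr)
        assume "\<not> pair_above f (rev B' @ rev A @ D)"
        then have "run123 D ys = run123 (f # rev B' @ rev A @ D) F'"
          by (simp add: run' Cons run123_push)
        then have "subseq (f # rev B' @ rev A @ D) (rev B @ S @ D)"
          using subseq_run123 run by metis
        moreover have "subseq [f, last B'] (f # rev B' @ rev A @ D)"
          using False by (simp add: subseq_singleton_left)
        ultimately have "subseq [f, last B'] (rev B @ S @ D)"
          using subseq_order.trans by blast
        moreover have "last B' \<notin> set S" "last B' \<notin> set D"
          using B' False small D_le last_in_set[of B'] by (meson less_asym not_le)+
        moreover have "b \<in> set V" if "subseq [a, b] V" for a b and V :: "nat list"
          using list_emb_set[OF that, of b] by auto
        ultimately have "subseq [f, last B'] (rev B)"
          unfolding subseq_pair_append set_append by blast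
        moreover have "sorted_wrt (>) (rev B)"
          using B by (simp add: sorted_wrt_rev)
        ultimately have "last B' < f" unfolding sorted_wrt_iff_subseq by blast
        with f lastE show False by simp
      qed
      moreover have "sorted_wrt (\<ge>) (rev B' @ rev A)"
        using E(1) unfolding EAB rev_append[symmetric] sorted_wrt_rev by (auto elim: sorted_wrt_mono_rel[rotated])
      ultimately obtain t where "t \<in> set A" "f < t"
        using decreasing_no_pair[of "rev B' @ rev A" f] decreasing_no_pair[OF D(1), of f] B' D_le
        unfolding pair_above_append by fastforce
      moreover have "t \<le> last A"
        using E(1) \<open>t \<in> set A\<close> unfolding EAB
        by (cases A rule: rev_cases) (auto simp: sorted_wrt_append)
      ultimately show ?thesis by simp
    qed (use f EAB in simp)
    then have pair: "pair_above f (rev A @ D)"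
      unfolding pair_above_append using \<open>A \<noteq> []\<close> \<open>last A < hd D\<close> D(2) by (metis last_in_set list.set_sel(1) set_rev)
    have revA: "rev A = last A # rev (butlast A)"
      using \<open>A \<noteq> []\<close> by (cases A rule: rev_cases) auto
    have "pair_above f (last A # rev (butlast A) @ D)" using pair revA by simp
    then have "run123 D ys = rev B' @ last A # run123 (rev (butlast A) @ D) (f # F')"
      using run123_pops[OF pair, of "rev B'" F'] by (simp add: run' Cons revA)
    then have "rev B = rev B'"
      using * split[OF B', of "last A # _"] \<open>last A < hd D\<close> by simp
    then show ?thesis
      using ysEF EAB Cons E(1) \<open>A \<noteq> []\<close> \<open>f < last A\<close>
      by (intro exI[of _ A] exI[of _ F]) (auto simp: sorted_wrt_append)
  qed
qed

section \<open>Fertility\<close>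

text \<open>
  The skew sum of the theorem is a list of three decreasing blocks: the largest \<open>h\<close> values, then the values
  below \<open>k\<close>, then \<open>k + t, \<dots>, k\<close>.
\<close>

lemma shape_eq:
  assumes "k \<ge> 2"
  shows "\<delta> h \<ominus> (\<delta> (k - 1) \<oplus> \<delta> (t + 1)) =
    rev [k + t + 1..<k + t + 1 + h] @ rev [1..<k] @ rev [k..<k + t + 1]"
proof -
  have shift: "map (\<lambda>v. c + v) (rev [1..<Suc m]) = rev [c + 1..<c + 1 + m]" for c m
  proof -
    have "map (\<lambda>v. c + v) [1..<Suc m] = [c + 1..<c + 1 + m]"
      by (induction m) auto
    then show ?thesis by (simp only: rev_map[symmetric])
  qed
  have "length (\<delta> (k - 1)) = k - 1" by (simp add: decr_perm_def del: upt_Suc)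
  then have "\<delta> (k - 1) \<oplus> \<delta> (t + 1) = rev [1..<k] @ rev [k..<k + t + 1]"
    using shift[of "k - 1" "t + 1"] assms
    by (cases k) (simp_all add: direct_sum_def decr_perm_def del: upt_Suc)
  moreover have "map (\<lambda>v. (k + t) + v) (\<delta> h) = rev [k + t + 1..<k + t + 1 + h]"
    unfolding decr_perm_def shift by simp
  ultimately show ?thesis
    unfolding skew_sum_def using assms by (simp del: upt_Suc)
qed

lemma is_perm_iff: "is_perm p \<longleftrightarrow> mset p = mset [1..<Suc (length p)]"
proof -
  have "is_perm p \<longleftrightarrow> distinct p \<and> set p = {1..<Suc (length p)}"
    by (auto simp: is_perm_def permutations_of_set_def atLeastLessThanSuc_atLeastAtMost)
  also have "\<dots> \<longleftrightarrow> mset p = mset [1..<Suc (length p)]"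
    by (metis atLeastLessThan_upt distinct_upt mset_eq_imp_distinct_iff mset_eq_setD set_eq_iff_mset_eq_distinct)
  finally show ?thesis .
qed

lemma is_perm_mset_cong: "mset p = mset q \<Longrightarrow> is_perm p \<longleftrightarrow> is_perm q"
  by (metis is_perm_iff size_mset)

lemma is_perm_shape:
  assumes "k \<ge> 2"
  shows "is_perm (rev [k + t + 1..<k + t + 1 + h] @ rev [1..<k] @ rev [k..<k + t + 1])"
proof -
  have "[1..<k + t + 1 + h] = [1..<k] @ [k..<k + t + 1] @ [k + t + 1..<k + t + 1 + h]"
    using assms upt_split[of 1 k "k + t + 1 + h"] upt_split[of k "k + t + 1" "k + t + 1 + h"]
    by (simp del: upt_Suc)
  then show ?thesis using assms
    unfolding is_perm_iff by (simp add: ac_simps del: upt_Suc)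
qed

text \<open>
  The inverse map keeps the letters below \<open>k\<close>. A preimage has first letter \<open>k\<close>, the last letter of
  the output. Its first ascending run is \<open>[k..<k + t + 1]\<close>, since in the output both the reversed run and the
  block \<open>k + t, \<dots>, k\<close> are what follows the letter \<open>1\<close>.
\<close>

lemma fertility_bij:
  fixes k t h :: nat
  assumes k: "k \<ge> 2"
  defines "B \<equiv> [k + t + 1..<k + t + 1 + h]"
  shows "bij_betw (\<lambda>s. [k..<k + t + 1] @ asc_run s @ B @ asc_rest s) (sortable12 1 k)
    {p. is_perm p \<and> \<S> [1, 2, 3] p = rev B @ rev [1..<k] @ rev [k..<k + t + 1]}"
    (is "bij_betw ?ins _ ?P")
proof (rule bij_betw_imageI)
  define D where "D = rev [k..<k + t + 1]"
  have D: "sorted_wrt (\<ge>) D" "D \<noteq> []" "hd D = k + t"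
    by (auto simp: D_def sorted_wrt_rev)
  have revD: "rev D = [k..<k + t + 1]" by (simp add: D_def)
  have B: "sorted_wrt (<) B" "\<forall>b\<in>set B. hd D < b" by (auto simp: B_def D simp del: upt_Suc)
  have start: "run123 [] (rev D @ xs) = run123 D xs" for xs
  proof -
    have "sorted_wrt (<) (rev D)" unfolding revD by (rule sorted_wrt_upt)
    from run123_push_ascending[OF this, of "[]" xs] show ?thesis by simp
  qed
  show "inj_on ?ins (sortable12 1 k)"
  proof (rule inj_on_inverseI[where g = "filter (\<lambda>x. x < k)"])
    fix s assume s: "s \<in> sortable12 1 k"
    have "filter (\<lambda>x. x < k) (?ins s) = filter (\<lambda>x. x < k) (asc_run s @ asc_rest s)"
      by (simp add: B_def filter_empty_conv del: upt_Suc)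
    then show "filter (\<lambda>x. x < k) (?ins s) = s"
      using sortable12_set[OF s] by (simp add: asc_run_split(1) filter_id_conv)
  qed
  show "?ins ` sortable12 1 k = ?P"
  proof (intro equalityI subsetI)
    fix p assume "p \<in> ?ins ` sortable12 1 k"
    then obtain s where s: "s \<in> sortable12 1 k" and p: "p = ?ins s" by auto
    define A where "A = asc_run s"
    define F where "F = asc_rest s"
    have set_s: "set s = {1..<k}" "distinct s" using sortable12_set[OF s] by auto
    have AF: "s = A @ F" "sorted_wrt (<) A" "F = [] \<or> A \<noteq> [] \<and> hd F < last A"
      using asc_run_split[of s] asc_rest_distinct[OF set_s(2)] by (auto simp: A_def F_def)
    have "run123 [] p = run123 D (A @ B @ F)"
      using start by (simp add: p A_def F_def revD)
    also have "\<dots> = rev B @ run12 [] (A @ F) @ D"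
      using set_s unfolding AF(1) by (intro run123_insert_large AF B D) (auto simp: D(3))
    also have "run12 [] (A @ F) = rev [1..<k]"
      using s by (simp add: sortable12_def AF(1))
    finally have run: "run123 [] p = rev B @ rev [1..<k] @ D" .
    then have "mset p = mset (rev B @ rev [1..<k] @ D)"
      using mset_run123[of "[]" p] by simp
    then have "is_perm p"
      using is_perm_shape[OF k, of t h] is_perm_mset_cong unfolding B_def D_def by blast
    with run show "p \<in> ?P" unfolding S123_eq D_def by simp
  next
    fix p assume "p \<in> ?P"
    then have perm: "is_perm p" and run: "run123 [] p = rev B @ rev [1..<k] @ D"
      unfolding S123_eq D_def by blast+
    have mset_p: "mset p = mset (rev B @ rev [1..<k] @ D)"
      unfolding run[symmetric] mset_run123 by simp
    have dist: "distinct p" and one_le: "\<forall>x\<in>set p. 1 \<le> x"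
      using perm by (auto simp: is_perm_def permutations_of_set_def)
    have one_in: "1 \<in> set p" using mset_eq_setD[OF mset_p] k by auto
    then have "p \<noteq> []" by auto
    define E where "E = asc_run p"
    define F where "F = asc_rest p"
    have EF: "p = E @ F" "sorted_wrt (<) E" "E \<noteq> []" and F: "F = [] \<or> hd F < last E"
      using asc_run_split[of p] asc_rest_distinct[OF dist] \<open>p \<noteq> []\<close> by (auto simp: E_def F_def)
    have "\<exists>W. run123 ([] @ [hd p]) (tl p) = W @ [hd p]"
      by (rule run123_base) simp
    then have "last (run123 [] p) = hd p"
      using \<open>p \<noteq> []\<close> by (cases p) auto
    moreover have "last D = k" by (simp add: D_def last_rev)
    ultimately have hdE: "hd E = k"
      using EF(1,3) D(2) unfolding run by simp
    then have E1: "\<forall>x\<in>set E. k \<le> x" using EF(2,3) by (cases E) auto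
    then have "1 \<notin> set E" using k by auto
    then have "1 \<in> set F" using one_in by (simp add: EF(1))
    obtain W where W: "run123 [] p = W @ 1 # rev E"
    proof -
      have "\<forall>x\<in>set E. 1 < x" using E1 k by auto
      moreover have "\<forall>x\<in>set F. 1 \<le> x" "distinct F" using one_le dist by (auto simp: EF(1))
      ultimately show ?thesis
        using run123_before_min[OF EF(1-3) F \<open>1 \<in> set F\<close>] that by blast
    qed
    have "E = rev D"
    proof -
      have "rev [1..<k] = rev [2..<k] @ [1]" using k upt_conv_Cons[of 1 k] by (simp add: numeral_2_eq_2)
      then have "rev D @ 1 # rev (rev B @ rev [2..<k]) = E @ 1 # rev W"
        using arg_cong[OF W, of rev] unfolding run by simp
      moreover have "1 \<notin> set (rev D)" "1 \<notin> set E" using E1 k by (auto simp: D_def)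
      moreover have "takeWhile (\<lambda>x. x \<noteq> 1) (xs @ 1 # ys) = xs" if "1 \<notin> set xs" for xs ys :: "nat list"
        using that by (induction xs) auto
      ultimately show ?thesis by metis
    qed
    have runF: "run123 D F = rev B @ rev [1..<k] @ D"
      using run start unfolding EF(1) \<open>E = rev D\<close> by simp
    have "\<exists>A F'. F = A @ B @ F' \<and> sorted_wrt (<) A \<and> (F' = [] \<or> A \<noteq> [] \<and> hd F' < last A)"
    proof (rule run123_insert_large_converse[OF D(1,2) _ _ _ B _ runF])
      show "F \<noteq> []" using \<open>1 \<in> set F\<close> by auto
      then show "hd F < hd D" using F \<open>E = rev D\<close> D(2) by (simp add: last_rev)
    qed (use dist EF(1) D in auto)
    then obtain A F' where AF: "F = A @ B @ F'" "sorted_wrt (<) A" "F' = [] \<or> A \<noteq> [] \<and> hd F' < last A"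
      by blast
    have "mset (A @ F') = mset (rev [1..<k])"
      using mset_p by (simp add: EF(1) \<open>E = rev D\<close> AF(1))
    from mset_eq_setD[OF this] have "set (A @ F') = {1..<k}" by simp
    then have "run123 D F = rev B @ run12 [] (A @ F') @ D"
      unfolding AF(1) by (intro run123_insert_large AF B D) (auto simp: D(3))
    then have "A @ F' \<in> sortable12 1 k"
      using runF by (simp add: sortable12_def)
    moreover have "asc_run (A @ F') = A" using AF by (intro asc_run_append) auto
    moreover from this have "asc_rest (A @ F') = F'" by (simp add: asc_rest_def)
    ultimately show "p \<in> ?ins ` sortable12 1 k"
      by (intro image_eqI[of _ _ "A @ F'"]) (simp_all add: EF(1) \<open>E = rev D\<close> AF(1) revD)
  qed
qed

lemma fertility_shape:
  assumes "k \<ge> 2"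
  shows "real (fertility [1, 2, 3] (\<delta> h \<ominus> (\<delta> (k - 1) \<oplus> \<delta> (t + 1)))) = catalan (k - 1)"
  using bij_betw_same_card[OF fertility_bij[OF assms, of t h]] card_sortable12[of 1 "k - 1"] assms
  unfolding fertility_def shape_eq[OF assms] by simp

section \<open>The 21-stack and the pattern 231\<close>

lemma run21_push: "sorted (x # st) \<Longrightarrow> stack_run [2, 1] st (x # xs) = stack_run [2, 1] (x # st) xs"
  by (cases st) (auto simp: contains_21_iff simp del: One_nat_def)

lemma run21_push_descending:
  "sorted (rev X @ st) \<Longrightarrow> stack_run [2, 1] st (X @ Y) = stack_run [2, 1] (rev X @ st) Y"
proof (induction X arbitrary: st)
  case (Cons x X)
  then show ?case
    using run21_push[of x st "X @ Y"] by (auto simp: sorted_append simp del: One_nat_def)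
qed simp

lemma run21_pops:
  "\<forall>u\<in>set U. u < x \<Longrightarrow> stack_run [2, 1] (U @ st) (x # Y) = U @ stack_run [2, 1] st (x # Y)"
  by (induction U) (auto simp: contains_21_iff not_le simp del: One_nat_def)

lemma mset_stack_run: "mset (stack_run s st xs) = mset st + mset xs"
  by (induction s st xs rule: stack_run.induct) auto

text \<open>
  The moment when the input letter \<open>b\<close> enters the 21-stack: what was read before is already in the output or
  lies in the sorted stack under \<open>b\<close>.
\<close>

lemma run21_pushed:
  "sorted st \<Longrightarrow> \<exists>P st'. stack_run [2, 1] st (X @ b # Y) = P @ stack_run [2, 1] (b # st') Y \<and>
     sorted (b # st') \<and> set st \<union> set X \<subseteq> set P \<union> set st'"
proof (induction "[2, 1] :: nat list" st "X @ b # Y" arbitrary: X rule: stack_run.induct)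
  case (2 x xs)
  show ?case
  proof (cases X)
    case Nil
    with 2 show ?thesis by (intro exI[of _ "[]"]) auto
  next
    case (Cons x' X')
    then show ?thesis using 2(1)[of X'] 2(2,3) by auto
  qed
next
  case (3 t st x xs)
  show ?case
  proof (cases "sorted (x # t # st)")
    case False
    then have *: "stack_run [2, 1] (t # st) (X @ b # Y) = t # stack_run [2, 1] st (X @ b # Y)"
      by (simp add: 3(3)[symmetric] contains_21_iff del: One_nat_def)
    obtain P st' where "stack_run [2, 1] st (X @ b # Y) = P @ stack_run [2, 1] (b # st') Y"
     "sorted (b # st')" "set st \<union> set X \<subseteq> set P \<union> set st'"
      using 3(1)[OF _ 3(3)] 3(4) False by (auto simp: contains_21_iff simp del: One_nat_def)
    then show ?thesis using * by (intro exI[of _ "t # P"] exI[of _ st']) auto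
  next
    case True
    then have *: "stack_run [2, 1] (t # st) (X @ b # Y) = stack_run [2, 1] (x # t # st) xs"
      by (simp add: 3(3)[symmetric] contains_21_iff del: One_nat_def)
    show ?thesis
    proof (cases X)
      case Nil
      then show ?thesis using True 3(3) * by (intro exI[of _ "[]"] exI[of _ "t # st"]) auto
    next
      case (Cons x' X')
      then have "\<exists>P st'. stack_run [2, 1] (x # t # st) (X' @ b # Y) = P @ stack_run [2, 1] (b # st') Y \<and>
          sorted (b # st') \<and> set (x # t # st) \<union> set X' \<subseteq> set P \<union> set st'"
        using True 3(3) by (intro 3(2)) (auto simp: contains_21_iff simp del: One_nat_def)
      with Cons * 3(3) show ?thesis by auto
    qed
  qed
qed simp

text \<open>
  The letter \<open>b\<close> drives out the smaller letter \<open>a\<close> before \<open>c\<close> is read, so \<open>a\<close> precedes \<open>c\<close> in the output.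
\<close>

lemma sorted_run21_avoids_231:
  assumes "sorted (stack_run [2, 1] [] (X @ b # Y))" "a \<in> set X" "c \<in> set Y" "a < b"
  shows "a \<le> c"
proof -
  obtain P st' where run: "stack_run [2, 1] [] (X @ b # Y) = P @ stack_run [2, 1] (b # st') Y"
    and st': "sorted (b # st')" "set X \<subseteq> set P \<union> set st'"
    using run21_pushed[of "[]" X b Y] by auto
  have "a \<in> set P" using st' assms(2,4) by (force simp: not_le[symmetric])
  moreover have "c \<in># mset (stack_run [2, 1] (b # st') Y)"
    unfolding mset_stack_run using assms(3) by simp
  ultimately show ?thesis using assms(1) unfolding run by (auto simp: sorted_append)
qed

text \<open>
  An ascent of \<open>W\<close> followed by \<open>m\<close> is a 231.
\<close>

lemma decreasing_before_min:
  assumes "sorted (stack_run [2, 1] [] (W @ m # Z))" "\<forall>x\<in>set W. m < x" "distinct W"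
  shows "sorted_wrt (>) (W @ [m])"
proof -
  have "b < a" if ab: "subseq [a, b] W" for a b
  proof -
    obtain X Y where W: "W = X @ b # Y" "a \<in> set X" using subseq_pairE[OF ab] .
    have "\<not> a < b"
    proof
      assume "a < b"
      with sorted_run21_avoids_231[of X b "Y @ m # Z" a m] assms(1) W have "a \<le> m" by simp
      moreover have "m < a" using assms(2) W by simp
      ultimately show False by simp
    qed
    moreover have "a \<noteq> b" using W assms(3) by auto
    ultimately show ?thesis by simp
  qed
  then have "sorted_wrt (>) W" unfolding sorted_wrt_iff_subseq by blast
  then show ?thesis using assms(2) by (simp add: sorted_wrt_append)
qed

section \<open>The 123-sorted permutations\<close>

text \<open>
  The first two blocks are pushed without pops. Then \<open>k + t\<close> drives out the letters below \<open>k\<close>, and the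
  rest of its block is pushed on top of the largest letters.
\<close>

lemma run21_shape:
  assumes "k \<ge> 2"
  shows "\<S> [2, 1] (rev [k + t + 1..<k + t + 1 + h] @ rev [1..<k] @ rev [k..<k + t + 1]) = [1..<k + t + 1 + h]"
proof -
  let ?B = "[k + t + 1..<k + t + 1 + h]"
  have M: "rev [k..<k + t + 1] = (k + t) # rev [k..<k + t]" by simp
  have "\<S> [2, 1] (rev ?B @ rev [1..<k] @ rev [k..<k + t + 1]) =
      stack_run [2, 1] ([1..<k] @ ?B) (rev [k..<k + t + 1])"
    using run21_push_descending[of "rev ?B @ rev [1..<k]" "[]" "rev [k..<k + t + 1]"]
    by (simp add: stack_map_def sorted_append del: upt_Suc One_nat_def)
  also have "\<dots> = [1..<k] @ stack_run [2, 1] ?B (rev [k..<k + t + 1])"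
    unfolding M by (rule run21_pops) auto
  also have "stack_run [2, 1] ?B (rev [k..<k + t + 1]) = [k..<k + t + 1] @ ?B"
    using run21_push_descending[of "rev [k..<k + t + 1]" ?B "[]"]
    by (simp add: sorted_append del: upt_Suc One_nat_def)
  also have "[1..<k] @ [k..<k + t + 1] @ ?B = [1..<k + t + 1 + h]"
    using assms upt_split[of 1 k "k + t + 1 + h"] upt_split[of k "k + t + 1" "k + t + 1 + h"]
    by (simp del: upt_Suc)
  finally show ?thesis .
qed

lemma shape_in_Sorted:
  assumes "k \<ge> 2"
  shows "\<delta> h \<ominus> (\<delta> (k - 1) \<oplus> \<delta> (t + 1)) \<in> Sorted (k + h + t) [1, 2, 3]"
proof -
  let ?g = "rev [k + t + 1..<k + t + 1 + h] @ rev [1..<k] @ rev [k..<k + t + 1]"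
  have "run12 [] ([1..<k] @ []) = rev [1..<k]"
    using run12_push_ascending[of "[1..<k]" "[]" "[]"] by simp
  then have "sortable12 1 k \<noteq> {}" by (auto simp: sortable12_def)
  then obtain p where p: "is_perm p" "\<S> [1, 2, 3] p = ?g"
    using bij_betw_imp_surj_on[OF fertility_bij[OF assms, of t h]] by blast
  have len: "length p = k + h + t"
  proof -
    have "mset ?g = mset p" using p(2) mset_run123[of "[]" p] unfolding S123_eq by simp
    from mset_eq_length[OF this] show ?thesis using assms by (simp del: upt_Suc)
  qed
  have "\<S> [2, 1] ?g = [1..<Suc (length p)]"
    using run21_shape[OF assms, of t h] by (simp add: len ac_simps)
  then have "sortable [1, 2, 3] p" using p by (simp only: sortable_def simp_thms)
  then show ?thesis
    using p is_perm_shape[OF assms, of t h] len assms unfolding Sorted_def shape_eq[OF assms]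
    by (auto simp del: upt_Suc One_nat_def)
qed

lemma decr_in_Sorted: "\<delta> n \<in> Sorted n [1, 2, 3]"
proof -
  have p: "is_perm [1..<Suc n]" and d: "is_perm (\<delta> n)" "length (\<delta> n) = n"
    by (auto simp: is_perm_iff decr_perm_def simp del: upt_Suc)
  have "\<S> [1, 2, 3] [1..<Suc n] = \<delta> n"
    using run123_push_ascending[of "[1..<Suc n]" "[]" "[]"]
    by (simp add: S123_eq decr_perm_def del: upt_Suc One_nat_def)
  moreover have "\<S> [2, 1] (\<delta> n) = [1..<Suc n]"
    using run21_push_descending[of "\<delta> n" "[]" "[]"]
    by (simp add: stack_map_def decr_perm_def del: upt_Suc One_nat_def)
  ultimately show ?thesis
    using p d by (auto simp: Sorted_def sortable_def simp del: upt_Suc One_nat_def intro!: exI[of _ "[1..<Suc n]"])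
qed

lemma strictly_decreasing_unique:
  fixes xs ys :: "nat list"
  shows "sorted_wrt (>) xs \<Longrightarrow> sorted_wrt (>) ys \<Longrightarrow> set xs = set ys \<Longrightarrow> xs = ys"
  using strict_sorted_equal[of "rev xs" "rev ys"] by (simp add: sorted_wrt_rev)

text \<open>
  If \<open>k\<close>, the first letter of the preimage, is \<open>1\<close>, the output ends with \<open>1\<close> and avoids 231, hence decreases.
  Otherwise it is \<open>W @ 1 # rev E\<close>, where \<open>W @ [1]\<close> decreases, and avoidance of 231 with \<open>l = last E\<close>
  in the middle and \<open>k\<close> at the end leaves no letter of \<open>W\<close> between \<open>k\<close> and \<open>l\<close>.
\<close>

lemma Sorted_shape:
  assumes "n \<ge> 1" and g: "g \<in> Sorted n [1, 2, 3]"
  shows "g = \<delta> n \<or> (\<exists>k h t. g = \<delta> h \<ominus> (\<delta> (k - 1) \<oplus> \<delta> (t + 1)) \<and> k \<ge> 2 \<and> k + h + t = n)"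
proof -
  obtain p where p: "is_perm p" "\<S> [2, 1] g = [1..<Suc (length p)]" "run123 [] p = g"
    using g unfolding Sorted_def sortable_def S123_eq by blast
  have sorted_g: "sorted (stack_run [2, 1] [] g)"
    using p(2) by (simp add: stack_map_def del: upt_Suc)
  have len: "length g = n" and "is_perm g" using g by (auto simp: Sorted_def)
  then have set_g: "set g = {1..n}" "distinct g" by (auto simp: is_perm_def permutations_of_set_def)
  have "mset p = mset g" unfolding p(3)[symmetric] mset_run123 by simp
  then have set_p: "set p = {1..n}" "distinct p"
    using set_g by (metis mset_eq_setD, metis mset_eq_imp_distinct_iff)
  then have "p \<noteq> []" using assms(1) by auto
  define E where "E = asc_run p"
  define F where "F = asc_rest p"
  have EF: "p = E @ F" "sorted_wrt (<) E" "E \<noteq> []" and F: "F = [] \<or> hd F < last E"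
    using asc_run_split[of p] asc_rest_distinct[OF set_p(2)] \<open>p \<noteq> []\<close> by (auto simp: E_def F_def)
  have hd_le: "\<forall>x\<in>set E. hd E \<le> x" using EF(2,3) by (cases E) auto
  have le_last: "\<forall>x\<in>set E. x \<le> last E" using EF(2,3) by (cases E rule: rev_cases) (auto simp: sorted_wrt_append)
  define k where "k = hd E"
  have k_in: "k \<in> set E" using EF(3) by (simp add: k_def)
  show ?thesis
  proof (cases "k = 1")
    case True
    have "\<exists>W. run123 ([] @ [hd p]) (tl p) = W @ [hd p]"
      by (rule run123_base) simp
    moreover have "hd p = 1" using True EF(1,3) by (simp add: k_def)
    moreover have "p = hd p # tl p" using \<open>p \<noteq> []\<close> by simp
    ultimately obtain W where W: "g = W @ [1]"
      using p(3) by (metis append_Nil run123.simps(2))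
    have "sorted_wrt (>) (W @ [1])"
    proof (rule decreasing_before_min[of W 1 "[]"])
      show "\<forall>x\<in>set W. 1 < x"
      proof
        fix x assume "x \<in> set W"
        then have "1 \<le> x" "x \<noteq> 1" using set_g unfolding W by auto
        then show "1 < x" by simp
      qed
    qed (use sorted_g set_g W in simp_all)
    moreover have "sorted_wrt (>) (rev [1..<Suc n])"
      by (simp add: sorted_wrt_rev del: upt_Suc)
    moreover have "set g = set (rev [1..<Suc n])"
      using set_g(1) by (simp add: atLeastLessThanSuc_atLeastAtMost del: upt_Suc)
    ultimately have "g = rev [1..<Suc n]"
      unfolding W by (rule strictly_decreasing_unique)
    then show ?thesis by (simp add: decr_perm_def)
  next
    case False
    have "k \<in> set p" using k_in EF(1) by simp
    then have "1 \<le> k" "k \<noteq> 1" using set_p(1) False by auto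
    then have k2: "k \<ge> 2" by simp
    define l where "l = last E"
    have E_ge: "\<forall>x\<in>set E. k \<le> x \<and> x \<le> l" using hd_le le_last by (auto simp: k_def l_def)
    have "1 \<in> set p" using set_p(1) assms(1) by simp
    moreover have "1 \<notin> set E" using E_ge k2 by auto
    ultimately have "1 \<in> set F" by (simp add: EF(1))
    obtain W where W: "g = W @ 1 # rev E"
    proof -
      have "\<forall>x\<in>set E. 1 < x" using E_ge k2 by auto
      moreover have "\<forall>x\<in>set F. 1 \<le> x" "distinct F" using set_p by (auto simp: EF(1))
      ultimately show ?thesis
        using run123_before_min[OF EF(1-3) F \<open>1 \<in> set F\<close>] that p(3) by blast
    qed
    have set_W: "set W \<union> {1} \<union> set E = {1..n}" "set W \<inter> set E = {}" "1 \<notin> set W" "distinct W"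
      using set_g unfolding W by auto
    have W_dec: "sorted_wrt (>) (W @ [1])"
    proof (rule decreasing_before_min)
      show "\<forall>x\<in>set W. 1 < x"
      proof
        fix x assume "x \<in> set W"
        then have "1 \<le> x" "x \<noteq> 1" using set_W by auto
        then show "1 < x" by simp
      qed
    qed (use sorted_g set_W W in simp_all)
    have split: "l < v" if "v \<in> set W" "k < v" for v
    proof (rule ccontr)
      assume "\<not> l < v"
      moreover have "l \<in> set E" using EF(3) by (simp add: l_def)
      ultimately have "v < l" using that(1) set_W(2) by (metis disjoint_iff linorder_neqE_nat)
      obtain E' where E': "E = k # E'" using EF(3) by (cases E) (auto simp: k_def)
      with \<open>v < l\<close> that(2) have "E' \<noteq> []" by (auto simp: l_def)
      then have "rev E = l # rev (butlast E') @ [k]"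
        using E' by (cases E' rule: rev_cases) (auto simp: l_def)
      then have "g = (W @ [1]) @ l # rev (butlast E') @ [k]" unfolding W by (simp only: append_assoc append.simps)
      then have "v \<le> k"
        using sorted_run21_avoids_231[of "W @ [1]" l "rev (butlast E') @ [k]" v k] sorted_g that(1) \<open>v < l\<close>
        by (simp only: set_append Un_iff list.set insert_iff simp_thms)
      with that(2) show False by simp
    qed
    define t where "t = l - k"
    define h where "h = n - l"
    have kl: "k \<le> l" "l \<le> n" using E_ge k_in set_W(1) EF(3) last_in_set[of E] by (auto simp: l_def)
    then have n: "k + h + t = n" and l: "l = k + t" by (auto simp: t_def h_def)
    have set_E: "set E = {k..l}"
    proof (intro equalityI subsetI)
      fix x assume x: "x \<in> {k..l}"
      have "x \<in> set W \<union> {1} \<union> set E" unfolding set_W(1) using x kl k2 by simp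
      moreover have "x \<notin> set W"
      proof (cases "x = k")
        case True
        then show ?thesis using set_W(2) k_in by blast
      next
        case False
        then show ?thesis using split[of x] x by fastforce
      qed
      moreover have "x \<noteq> 1" using x k2 by simp
      ultimately show "x \<in> set E" by blast
    next
      fix x assume "x \<in> set E"
      then show "x \<in> {k..l}" using E_ge by simp
    qed
    have "set E = set [k..<k + t + 1]"
      unfolding set_E l by (simp add: atLeastLessThanSuc_atLeastAtMost del: upt_Suc)
    then have "E = [k..<k + t + 1]"
      by (metis EF(2) sorted_wrt_upt strict_sorted_equal)
    moreover have "W @ [1] = rev [k + t + 1..<k + t + 1 + h] @ rev [1..<k]"
    proof (rule strictly_decreasing_unique[OF W_dec])
      show "sorted_wrt (>) (rev [k + t + 1..<k + t + 1 + h] @ rev [1..<k])"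
        by (auto simp: sorted_wrt_append sorted_wrt_rev simp del: upt_Suc)
      have "1 \<notin> set E" using set_E k2 by simp
      then have "set (W @ [1]) = {1..n} - {k..l}"
        unfolding set_W(1)[symmetric] set_E[symmetric] using set_W(2) by fastforce
      also have "\<dots> = set (rev [k + t + 1..<k + t + 1 + h] @ rev [1..<k])"
        unfolding n[symmetric] l by (auto simp del: upt_Suc)
      finally show "set (W @ [1]) = set (rev [k + t + 1..<k + t + 1 + h] @ rev [1..<k])" .
    qed
    ultimately have "g = \<delta> h \<ominus> (\<delta> (k - 1) \<oplus> \<delta> (t + 1))"
      using arg_cong[of "W @ [1]" _ "\<lambda>xs. xs @ rev E"] unfolding shape_eq[OF k2] W
      by (simp del: upt_Suc)
    then show ?thesis using k2 n by blast
  qed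
qed

lemma shape_not_decr:
  assumes "k \<ge> 2"
  shows "\<delta> h \<ominus> (\<delta> (k - 1) \<oplus> \<delta> (t + 1)) \<noteq> \<delta> n"
proof
  assume eq: "\<delta> h \<ominus> (\<delta> (k - 1) \<oplus> \<delta> (t + 1)) = \<delta> n"
  have "sorted_wrt (>) (\<delta> n)" by (simp add: decr_perm_def sorted_wrt_rev del: upt_Suc)
  then have "\<forall>x\<in>set (rev [1..<k]). \<forall>y\<in>set (rev [k..<k + t + 1]). y < x"
    unfolding eq[symmetric] shape_eq[OF assms] sorted_wrt_append by blast
  moreover have "1 \<in> set (rev [1..<k])" "k \<in> set (rev [k..<k + t + 1])"
    using assms by (simp_all del: upt_Suc)
  ultimately have "k < 1" by blast
  with assms show False by simp
qed

theorem corollary7p7: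
  shows "(\<forall>n\<ge>1.
      Sorted n [1, 2, 3] =
        {\<delta> h \<ominus> (\<delta> (k - 1) \<oplus> \<delta> (t + 1)) | k h t :: nat. k \<ge> 2 \<and> k + h + t = n} \<union> {\<delta> n} \<and>
      {\<delta> h \<ominus> (\<delta> (k - 1) \<oplus> \<delta> (t + 1)) | k h t :: nat. k \<ge> 2 \<and> k + h + t = n} \<inter> {\<delta> n} = {}) \<and>
    (\<forall>k h t :: nat. k \<ge> 2 \<longrightarrow>
      real (fertility [1, 2, 3] (\<delta> h \<ominus> (\<delta> (k - 1) \<oplus> \<delta> (t + 1)))) =
        1 / real k * real ((2 * k - 2) choose (k - 1)))"
proof (intro conjI allI impI)
  fix n :: nat assume n: "n \<ge> 1"
  let ?shapes = "{\<delta> h \<ominus> (\<delta> (k - 1) \<oplus> \<delta> (t + 1)) | k h t :: nat. k \<ge> 2 \<and> k + h + t = n}"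
  show "Sorted n [1, 2, 3] = ?shapes \<union> {\<delta> n}"
  proof (intro equalityI subsetI)
    fix g assume "g \<in> Sorted n [1, 2, 3]"
    from Sorted_shape[OF n this] show "g \<in> ?shapes \<union> {\<delta> n}" by blast
  next
    fix g assume "g \<in> ?shapes \<union> {\<delta> n}"
    then have "g = \<delta> n \<or> (\<exists>k h t. g = \<delta> h \<ominus> (\<delta> (k - 1) \<oplus> \<delta> (t + 1)) \<and> k \<ge> 2 \<and> k + h + t = n)"
      by (simp only: Un_iff mem_Collect_eq singleton_iff disj_commute)
    then show "g \<in> Sorted n [1, 2, 3]"
    proof (elim disjE exE conjE)
      fix k h t :: nat
      assume "g = \<delta> h \<ominus> (\<delta> (k - 1) \<oplus> \<delta> (t + 1))" and "k \<ge> 2" and "k + h + t = n"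
      then show ?thesis using shape_in_Sorted[of k h t] by (simp only:)
    qed (simp only: decr_in_Sorted)
  qed
  show "?shapes \<inter> {\<delta> n} = {}"
    using shape_not_decr by blast
next
  fix k h t :: nat assume k: "k \<ge> 2"
  have "2 * (k - 1) = 2 * k - 2" "k - 1 + 1 = k" using k by simp_all
  then show "real (fertility [1, 2, 3] (\<delta> h \<ominus> (\<delta> (k - 1) \<oplus> \<delta> (t + 1)))) =
      1 / real k * real ((2 * k - 2) choose (k - 1))"
    unfolding fertility_shape[OF k] catalan_def by (simp only: times_divide_eq_left mult_1_left)
qed

end
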